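(* For every positive integer $n$, $\sigma\overline{\mathrm{mex}}(n) = D_3(n)$, where $D_3(n)$ denotes the number of partitions of $n$ into distinct parts using three colors (i.e., the coefficient of $q^n$ in $\prod_{j\ge 1}(1+q^j)^3$).
   Context: An overpartition of $n$ is a non-increasing sequence of positive integers summing to $n$ in which the first occurrence of each distinct part may be overlined. For an overpartition $\pi$, $\overline{\mathrm{mex}}(\pi)$ is the smallest positive integer that does not occur among the non-overlined parts of $\pi$. For a positive integer $n$, $\sigma\overline{\mathrm{mex}}(n)=\sum_{\pi}\overline{\mathrm{mex}}(\pi)$, the sum over all overpartitions $\pi$ of $n$; by convention $\sigma\overline{\mathrm{mex}}(0)=1$. *)

theory Defs
  imports "HOL-Analysis.Analysis"
begin

text \<open>
  A list entry \<open>(k, b)\<close> is an occurrence of the part \<open>k\<close>, which is overlined iff \<open>b\<close>.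
\<close>

definition overpartition :: "nat \<Rightarrow> (nat \<times> bool) list \<Rightarrow> bool" where
  "overpartition n xs \<longleftrightarrow>
     sorted_wrt (\<ge>) (map fst xs) \<and>
     (\<forall>x\<in>set xs. fst x > 0) \<and>
     sum_list (map fst xs) = n \<and>
     (\<forall>i<length xs. snd (xs ! i) \<longrightarrow> (\<forall>j<i. fst (xs ! j) \<noteq> fst (xs ! i)))"

definition mex_bar :: "(nat \<times> bool) list \<Rightarrow> nat" where
  "mex_bar xs = (LEAST m. m > 0 \<and> (m, False) \<notin> set xs)"

definition sigma_mex_bar :: "nat \<Rightarrow> nat" where
  "sigma_mex_bar n = (\<Sum>xs | overpartition n xs. mex_bar xs)"

text \<open>
  A partition into distinct parts using three colours is the set of its coloured parts
  \<open>(k, c)\<close>: the same size may occur in different colours, but at most once in each.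
\<close>

definition coloured_distinct_partition3 :: "nat \<Rightarrow> (nat \<times> nat) set \<Rightarrow> bool" where
  "coloured_distinct_partition3 n S \<longleftrightarrow>
     finite S \<and> (\<forall>(k, c)\<in>S. k > 0 \<and> c < 3) \<and> (\<Sum>(k, c)\<in>S. k) = n"

definition D3 :: "nat \<Rightarrow> nat" where
  "D3 n = card {S. coloured_distinct_partition3 n S}"

lemma finite_overpartitions: "finite {xs. overpartition n xs}"
proof (rule finite_subset)
  show "{xs. overpartition n xs} \<subseteq> {xs. set xs \<subseteq> {..n} \<times> UNIV \<and> length xs \<le> n}"
  proof clarify
    fix xs assume "overpartition n xs"
    hence pos: "\<forall>x\<in>set xs. fst x > 0" and n: "sum_list (map fst xs) = n"
      by (auto simp: overpartition_def)
    have "length xs \<le> sum_list (map fst xs)"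
      using pos by (induction xs) auto
    moreover have "fst x \<le> n" if "x \<in> set xs" for x
      using that n member_le_sum_list[of "fst x" "map fst xs"] by simp
    ultimately show "set xs \<subseteq> {..n} \<times> UNIV \<and> length xs \<le> n"
      using n by auto
  qed
qed (intro finite_lists_length_le finite_cartesian_product; simp)

lemma sigma_mex_bar_0: "sigma_mex_bar 0 = 1"
proof -
  have "xs = []" if "overpartition 0 xs" for xs
    using that by (cases xs) (auto simp: overpartition_def)
  hence "{xs. overpartition 0 xs} = {[]}"
    by (auto simp: overpartition_def)
  moreover have "mex_bar [] = 1"
    unfolding mex_bar_def by (rule Least_equality) auto
  ultimately show ?thesis by (simp add: sigma_mex_bar_def)
qed

lemma coloured_distinct_partition3_bounded:
  assumes "n \<le> N"
  shows "{S. coloured_distinct_partition3 n S} =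
         {S \<in> Pow ({1..N} \<times> {..<3}). (\<Sum>(k, c)\<in>S. k) = n}"
proof (intro equalityI subsetI)
  fix S assume "S \<in> {S. coloured_distinct_partition3 n S}"
  hence S: "finite S" "\<forall>(k, c)\<in>S. k > 0 \<and> c < 3" "(\<Sum>(k, c)\<in>S. k) = n"
    by (auto simp: coloured_distinct_partition3_def)
  have "k \<le> n" if "(k, c) \<in> S" for k c
    using member_le_sum[of "(k, c)" S "\<lambda>(k, c). k"] that S by auto
  thus "S \<in> {S \<in> Pow ({1..N} \<times> {..<3}). (\<Sum>(k, c)\<in>S. k) = n}"
    using S assms by fastforce
next
  fix S assume "S \<in> {S \<in> Pow ({1..N} \<times> {..<(3::nat)}). (\<Sum>(k, c)\<in>S. k) = n}"
  moreover from this have "finite S"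
    by (simp add: finite_subset[of S "{1..N} \<times> {..<3}"])
  ultimately show "S \<in> {S. coloured_distinct_partition3 n S}"
    by (auto simp: coloured_distinct_partition3_def)
qed

lemma D3_partial_product:
  assumes "n \<le> N"
  shows "fps_nth (\<Prod>j=1..N. (1 + fps_X ^ j) ^ 3) n = (of_nat (D3 n) :: 'a :: comm_ring_1)"
proof -
  let ?A = "{1..N} \<times> {..<(3::nat)}"
  have "(\<Prod>j=1..N. (1 + fps_X ^ j :: 'a fps) ^ 3) = (\<Prod>(k, c)\<in>?A. 1 + fps_X ^ k)"
    by (simp flip: prod.cartesian_product)
  also have "\<dots> = (\<Prod>x\<in>?A. fps_X ^ fst x + 1)"
    by (intro prod.cong) auto
  also have "\<dots> = (\<Sum>S\<in>Pow ?A. (\<Prod>x\<in>S. fps_X ^ fst x) * (\<Prod>x\<in>?A - S. 1))"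
    by (rule prod_add) auto
  also have "\<dots> = (\<Sum>S\<in>Pow ?A. fps_X ^ (\<Sum>(k, c)\<in>S. k))"
    by (simp add: power_sum case_prod_unfold)
  finally have prod_eq: "(\<Prod>j=1..N. (1 + fps_X ^ j :: 'a fps) ^ 3) =
      (\<Sum>S\<in>Pow ?A. fps_X ^ (\<Sum>(k, c)\<in>S. k))" .
  have "fps_nth (\<Prod>j=1..N. (1 + fps_X ^ j :: 'a fps) ^ 3) n =
      (\<Sum>S\<in>Pow ?A. if (\<Sum>(k, c)\<in>S. k) = n then 1 else 0)"
    unfolding prod_eq fps_sum_nth by (intro sum.cong refl) simp
  also have "\<dots> = of_nat (card {S \<in> Pow ?A. (\<Sum>(k, c)\<in>S. k) = n})"
    by (simp add: sum.If_cases Int_def)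
  finally show ?thesis
    by (simp only: D3_def coloured_distinct_partition3_bounded[OF assms])
qed

lemma has_prod_D3:
  "(\<lambda>j. (1 + fps_X ^ Suc j) ^ 3) has_prod Abs_fps (\<lambda>n. of_nat (D3 n) :: 'a :: comm_ring_1)"
proof -
  let ?F = "Abs_fps (\<lambda>n. of_nat (D3 n) :: 'a)"
  have "(\<lambda>N. \<Prod>j\<le>N. (1 + fps_X ^ Suc j) ^ 3) \<longlonglongrightarrow> ?F"
  proof (rule tendsto_fpsI)
    fix n
    show "\<forall>\<^sub>F N in sequentially. fps_nth (\<Prod>j\<le>N. (1 + fps_X ^ Suc j) ^ 3) n = fps_nth ?F n"
      using eventually_ge_at_top[of n]
    proof eventually_elim
      case (elim N)
      have "(\<Prod>j\<le>N. (1 + fps_X ^ Suc j :: 'a fps) ^ 3) = (\<Prod>j=1..Suc N. (1 + fps_X ^ j) ^ 3)"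
        by (rule prod.reindex_bij_witness[of _ "\<lambda>j. j - 1" Suc]) auto
      thus ?case using elim D3_partial_product[of n "Suc N", where 'a = 'a] by simp
    qed
  qed
  moreover have "fps_nth ?F 0 = 1"
    using D3_partial_product[of 0 0, where 'a = 'a] by simp
  hence "?F \<noteq> 0" by (intro notI) simp
  ultimately show ?thesis
    by (simp add: has_prod_def raw_has_prod_def)
qed

end

theory Submission
  imports Defs
begin

text \<open>
  The sum of \<open>mex\<close> over the overpartitions of \<open>n\<close> is the sum over \<open>m \<ge> 0\<close> of the number of
  overpartitions with \<open>mex > m\<close>, that is, with all of \<open>1, \<dots>, m\<close> as non-overlined parts. Taking one
  copy of each of these parts away shows that their generating function is
  \<open>q\<^bsup>m(m+1)/2\<^esup> \<Prod>(1 + q\<^sup>j)/(1 - q\<^sup>j)\<close>. The theorem thus follows from the identity of Gauss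
  \<open>\<Sum> q\<^bsup>m(m+1)/2\<^esup> = \<Prod>(1 - q\<^bsup>2j\<^esup>)/(1 - q\<^bsup>2j-1\<^esup>)\<close> and the identity of Euler
  \<open>\<Prod>(1 + q\<^sup>j) (1 - q\<^bsup>2j-1\<^esup>) = 1\<close>. The former is the limit of a finite identity of Shanks.
  For a fixed \<open>n\<close> it suffices to compare finite products modulo \<open>q\<^bsup>n+1\<^esup>\<close>.
\<close>

section \<open>Shanks' finite form of the identity of Gauss\<close>

text \<open>
  With \<open>P\<^sub>n = \<Prod>\<^bsub>k<n\<^esub> (1 - x\<^bsup>2k+2\<^esup>)/(1 - x\<^bsup>2k+1\<^esup>)\<close>, Shanks' summand is \<open>x\<^bsup>s(2n+1)\<^esup> P\<^sub>n/P\<^sub>s\<close>. It is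
  multiplied here by the denominator of \<open>P\<^sub>n\<close> to stay in a commutative ring.
\<close>

definition shanks_term :: "'a :: comm_ring_1 \<Rightarrow> nat \<Rightarrow> nat \<Rightarrow> 'a" where
  "shanks_term x n s =
     x ^ (s * (2 * n + 1)) * (\<Prod>k\<in>{s..<n}. 1 - x ^ (2 * k + 2)) * (\<Prod>k<s. 1 - x ^ (2 * k + 1))"

lemma shanks_term_Suc_left:
  assumes "s \<le> n"
  shows "shanks_term x (Suc n) s = shanks_term x n s * x ^ (2 * s) * (1 - x ^ (2 * n + 2))"
proof -
  have "x ^ (s * (2 * Suc n + 1)) = x ^ (s * (2 * n + 1)) * x ^ (2 * s)"
    by (simp add: algebra_simps flip: power_add)
  thus ?thesis
    unfolding shanks_term_def prod.atLeastLessThan_Suc[OF assms] by (simp only: mult_ac)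
qed

text \<open>The ratio of consecutive summands, cleared of denominators: passing from s to s + 1
  moves index s from the even product to the odd one.\<close>

lemma shanks_term_Suc_right:
  assumes "s < n"
  shows "shanks_term x n (Suc s) * (1 - x ^ (2 * s + 2)) =
         shanks_term x n s * (1 - x ^ (2 * s + 1)) * x ^ (2 * n + 1)"
proof -
  have "(\<Prod>k\<in>{s..<n}. 1 - x ^ (2 * k + 2)) =
        (1 - x ^ (2 * s + 2)) * (\<Prod>k\<in>{Suc s..<n}. 1 - x ^ (2 * k + 2))"
    using assms by (rule prod.atLeast_Suc_lessThan)
  moreover have "x ^ (Suc s * (2 * n + 1)) = x ^ (s * (2 * n + 1)) * x ^ (2 * n + 1)"
    by (simp add: power_add algebra_simps)
  ultimately show ?thesis
    unfolding shanks_term_def prod.lessThan_Suc by (simp only: mult_ac)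
qed

text \<open>Induction on n in the style of Wilf and Zeilberger: apart from the new summand s = n,
  the passage from n to n + 1 changes the sum by a telescoping one, with certificate
  \<open>?G\<close>.\<close>

lemma sum_shanks_term:
  "(\<Sum>s<n. shanks_term x n s) =
     (\<Prod>k<n. 1 - x ^ (2 * k + 1)) * (\<Sum>s<2 * n. x ^ (s * (s + 1) div 2))"
proof (induction n)
  case (Suc n)
  let ?G = "\<lambda>s. shanks_term x n s * (1 - x ^ (2 * s))"
  let ?Q = "\<Prod>k<n. 1 - x ^ (2 * k + 1)"
  let ?S = "\<Sum>s<2 * n. x ^ (s * (s + 1) div 2)"
  let ?T = "x ^ (n * (2 * n + 1))"
  have last: "shanks_term x n n = ?T * ?Q"
    by (simp add: shanks_term_def)
  have "shanks_term x (Suc n) s - (1 - x ^ (2 * n + 1)) * shanks_term x n s = ?G (Suc s) - ?G s"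
    if "s < n" for s
  proof -
    have G: "?G (Suc s) = shanks_term x n s * (1 - x ^ (2 * s + 1)) * x ^ (2 * n + 1)"
      using shanks_term_Suc_right[OF that, of x] by simp
    have T: "shanks_term x (Suc n) s =
        shanks_term x n s * x ^ (2 * s) * (1 - x ^ (2 * n + 2))"
      using that by (intro shanks_term_Suc_left) simp
    show ?thesis unfolding G T by (simp add: algebra_simps power_add)
  qed
  hence "(\<Sum>s<n. shanks_term x (Suc n) s - (1 - x ^ (2 * n + 1)) * shanks_term x n s) =
         (\<Sum>s<n. ?G (Suc s) - ?G s)"
    by (intro sum.cong) auto
  also have "\<dots> = ?G n - ?G 0"
    by (rule sum_lessThan_telescope)
  \<comment> \<open>\<open>?G 0\<close> vanishes because of its factor 1 - x^0.\<close>
  finally have diff: "(\<Sum>s<n. shanks_term x (Suc n) s) =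
      (1 - x ^ (2 * n + 1)) * (?Q * ?S) + ?T * ?Q * (1 - x ^ (2 * n))"
    by (simp add: sum_subtractf last Suc.IH diff_eq_eq add.commute flip: sum_distrib_left)
  \<comment> \<open>The two exponents that the range s < 2(n + 1) adds to s < 2n.\<close>
  have exps: "2 * n * (2 * n + 1) div 2 = n * (2 * n + 1)"
    "Suc (2 * n) * (Suc (2 * n) + 1) div 2 = n * (2 * n + 1) + (2 * n + 1)"
    by (simp_all add: algebra_simps)
  have "(\<Sum>s<Suc n. shanks_term x (Suc n) s) =
      (1 - x ^ (2 * n + 1)) * (?Q * ?S) + ?T * ?Q * (1 - x ^ (2 * n)) +
      ?T * ?Q * x ^ (2 * n) * (1 - x ^ (2 * n + 2))"
    by (simp only: sum.lessThan_Suc diff shanks_term_Suc_left[OF order.refl] last)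
  also have "\<dots> = (?Q * (1 - x ^ (2 * n + 1))) * (?S + ?T + ?T * x ^ (2 * n + 1))"
    by (simp add: algebra_simps power_add)
  also have "\<dots> = (\<Prod>k<Suc n. 1 - x ^ (2 * k + 1)) * (\<Sum>s<2 * Suc n. x ^ (s * (s + 1) div 2))"
    by (simp only: mult_Suc_right add_2_eq_Suc sum.lessThan_Suc prod.lessThan_Suc exps power_add)
  finally show ?case .
qed simp

lemma shanks_term_0: "shanks_term x n 0 = (\<Prod>k<n. 1 - x ^ (2 * k + 2))"
  by (simp add: shanks_term_def atLeast0LessThan)

text \<open>Only the summand s = 0 survives modulo x^(2n+1); this congruence replaces the limit in
  n.\<close>

lemma dvd_shanks_term: "s > 0 \<Longrightarrow> x ^ (2 * n + 1) dvd shanks_term x n s"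
  unfolding shanks_term_def
  using mult_le_mono1[of 1 s "2 * n + 1"] by (intro dvd_mult2 le_imp_power_dvd) simp

section \<open>Congruences of products\<close>

text \<open>Here and below, \<open>m dvd a - b\<close> plays the role of a congruence modulo
  m.\<close>

lemma dvd_diff_mult:
  fixes a b c d m :: "'a :: comm_ring_1"
  assumes "m dvd a - b" "m dvd c - d"
  shows "m dvd a * c - b * d"
proof -
  have "a * c - b * d = (a - b) * c + b * (c - d)"
    by (simp add: algebra_simps)
  thus ?thesis using assms by simp
qed

lemma dvd_diff_mult_left:
  fixes a b c m :: "'a :: comm_ring_1"
  assumes "m dvd a - b"
  shows "m dvd c * a - c * b"
  using assms by (simp flip: right_diff_distrib)

lemma dvd_diff_prod:
  fixes f g :: "'b \<Rightarrow> 'a :: comm_ring_1"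
  assumes "\<And>i. i \<in> A \<Longrightarrow> m dvd f i - g i"
  shows "m dvd prod f A - prod g A"
  using assms by (induction A rule: infinite_finite_induct) (auto intro!: dvd_diff_mult)

lemma dvd_diff_trans:
  fixes a b c m :: "'a :: comm_ring_1"
  assumes "m dvd a - b" "m dvd b - c"
  shows "m dvd a - c"
  using dvd_add[OF assms] by simp

lemma prod_one_minus_odd_even:
  fixes x :: "'a :: comm_ring_1"
  shows "(\<Prod>k<n. 1 - x ^ (2 * k + 1)) * (\<Prod>k<n. 1 - x ^ (2 * k + 2)) = (\<Prod>k=1..2 * n. 1 - x ^ k)"
  by (induction n) (simp_all add: mult_ac)

lemma prod_one_minus_even:
  fixes x :: "'a :: comm_ring_1"
  shows "(\<Prod>k<n. 1 - x ^ (2 * k + 2)) = (\<Prod>k=1..n. 1 - x ^ k) * (\<Prod>k=1..n. 1 + x ^ k)"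
proof (induction n)
  case (Suc n)
  have "x ^ (2 * n + 2) = x ^ Suc n * x ^ Suc n"
    by (simp add: mult_2 flip: power_add del: power_Suc)
  hence "1 - x ^ (2 * n + 2) = (1 - x ^ Suc n) * (1 + x ^ Suc n)"
    by (simp only: algebra_simps mult_1_left mult_1_right)
  thus ?case using Suc by (simp add: mult_ac del: power_Suc)
qed simp

text \<open>Each factor with k > n is congruent to 1.\<close>

lemma dvd_diff_prod_one_minus:
  fixes x :: "'a :: comm_ring_1"
  assumes "n \<le> m"
  shows "x ^ Suc n dvd (\<Prod>k=1..m. 1 - x ^ k) - (\<Prod>k=1..n. 1 - x ^ k)"
proof -
  have "(\<Prod>k=1..m. 1 - x ^ k) = (\<Prod>k=1..n. 1 - x ^ k) * (\<Prod>k=n+1..m. 1 - x ^ k)"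
    using prod.ub_add_nat[of 1 n "\<lambda>k. 1 - x ^ k" "m - n"] assms by simp
  moreover have "x ^ Suc n dvd (\<Prod>k=n+1..m. 1 - x ^ k) - (\<Prod>k=n+1..m. 1)"
  proof (rule dvd_diff_prod)
    fix k assume "k \<in> {n+1..m}"
    hence "x ^ Suc n dvd x ^ k" by (intro le_imp_power_dvd) simp
    thus "x ^ Suc n dvd 1 - x ^ k - 1" by simp
  qed
  ultimately show ?thesis
    using dvd_diff_mult_left[of "x ^ Suc n" _ _ "\<Prod>k=1..n. 1 - x ^ k"] by fastforce
qed

section \<open>Truncated power series and the identities of Euler and Gauss\<close>

lemma fps_X_power_dvd_iff:
  fixes f :: "'a :: field fps"
  shows "fps_X ^ n dvd f \<longleftrightarrow> (\<forall>k<n. fps_nth f k = 0)"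
proof
  assume "fps_X ^ n dvd f"
  thus "\<forall>k<n. fps_nth f k = 0" by (auto simp: dvd_def fps_X_power_mult_nth)
next
  assume "\<forall>k<n. fps_nth f k = 0"
  hence "fps_cutoff n f = 0" by (simp add: fps_eq_iff)
  thus "fps_X ^ n dvd f" using fps_shift_cutoff'[of n f] by (metis add.right_neutral dvd_triv_left)
qed

text \<open>Over a field, a power series with nonzero constant coefficient is a unit.\<close>

lemma fps_X_power_dvd_cancel:
  fixes u f :: "'a :: field fps"
  assumes "fps_X ^ n dvd u * f" "fps_nth u 0 \<noteq> 0"
  shows "fps_X ^ n dvd f"
  using assms by (simp add: dvd_mult_unit_iff')

lemma prod_one_minus_X_nth_0:
  "fps_nth (\<Prod>k=1..n. 1 - fps_X ^ k :: 'a :: field fps) 0 = 1"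
  by (induction n) simp_all

text \<open>Let E_n be the product of 1 - X^k over k \<le> n. Multiplied by E_n, the difference
  becomes E_2n - E_n, since the odd and even factors together form E_2n; then the unit E_n is
  cancelled.\<close>

lemma euler_odd_distinct:
  "fps_X ^ Suc n dvd
     (\<Prod>k<n. 1 - fps_X ^ (2 * k + 1)) * (\<Prod>k=1..n. 1 + fps_X ^ k) - (1 :: 'a :: field fps)"
proof (rule fps_X_power_dvd_cancel)
  show "fps_X ^ Suc n dvd (\<Prod>k=1..n. 1 - fps_X ^ k) *
    ((\<Prod>k<n. 1 - fps_X ^ (2 * k + 1)) * (\<Prod>k=1..n. 1 + fps_X ^ k) - (1 :: 'a :: field fps))"
    using dvd_diff_prod_one_minus[of n "2 * n" "fps_X :: 'a fps"]
      prod_one_minus_odd_even[of "fps_X :: 'a fps" n] prod_one_minus_even[of "fps_X :: 'a fps" n]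
    by (simp add: algebra_simps)
qed (subst prod_one_minus_X_nth_0, simp)

text \<open>Two truncations of \<open>sum_shanks_term\<close>: the summands with s \<ge> 1 on the
  left and the triangular powers with s > n on the right all vanish modulo x^(n+1).\<close>

lemma gauss_triangular:
  fixes x :: "'a :: comm_ring_1"
  assumes "n \<ge> 1"
  shows "x ^ Suc n dvd (\<Prod>k<n. 1 - x ^ (2 * k + 1)) * (\<Sum>s\<le>n. x ^ (s * (s + 1) div 2))
           - (\<Prod>k<n. 1 - x ^ (2 * k + 2))"
proof -
  have "x ^ Suc n dvd (\<Sum>s\<in>{1..<n}. shanks_term x n s)"
  proof (rule dvd_sum)
    fix s assume "s \<in> {1..<n}"
    hence "x ^ (2 * n + 1) dvd shanks_term x n s" by (intro dvd_shanks_term) simp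
    moreover have "x ^ Suc n dvd x ^ (2 * n + 1)" by (intro le_imp_power_dvd) simp
    ultimately show "x ^ Suc n dvd shanks_term x n s" by (rule dvd_trans[rotated])
  qed
  moreover have "(\<Sum>s<n. shanks_term x n s) =
      shanks_term x n 0 + (\<Sum>s\<in>{1..<n}. shanks_term x n s)"
    using assms by (simp add: lessThan_atLeast0 sum.atLeast_Suc_lessThan)
  ultimately have A: "x ^ Suc n dvd (\<Sum>s<n. shanks_term x n s) - (\<Prod>k<n. 1 - x ^ (2 * k + 2))"
    by (simp add: shanks_term_0)
  have "(\<Sum>s<2 * n. x ^ (s * (s + 1) div 2)) =
      (\<Sum>s\<le>n. x ^ (s * (s + 1) div 2)) + (\<Sum>s\<in>{n<..<2 * n}. x ^ (s * (s + 1) div 2))"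
  proof (subst sum.union_disjoint[symmetric])
    show "(\<Sum>s<2 * n. x ^ (s * (s + 1) div 2)) =
          (\<Sum>s\<in>{..n} \<union> {n<..<2 * n}. x ^ (s * (s + 1) div 2))"
      \<comment> \<open>For n \<ge> 1 the index s = n lies below 2n.\<close>
      using assms by (intro sum.cong) auto
  qed auto
  moreover have "x ^ Suc n dvd (\<Sum>s\<in>{n<..<2 * n}. x ^ (s * (s + 1) div 2))"
  proof (intro dvd_sum le_imp_power_dvd)
    fix s assume s: "s \<in> {n<..<2 * n}"
    \<comment> \<open>Here s \<ge> n + 1 and s + 1 \<ge> 2.\<close>
    hence "Suc n * 2 \<le> s * (s + 1)" using assms by (intro mult_le_mono) auto
    from div_le_mono[OF this, of 2] show "Suc n \<le> s * (s + 1) div 2"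
      by (simp only: nonzero_mult_div_cancel_right)
  qed
  ultimately have "x ^ Suc n dvd
      (\<Sum>s\<le>n. x ^ (s * (s + 1) div 2)) - (\<Sum>s<2 * n. x ^ (s * (s + 1) div 2))"
    by simp
  hence "x ^ Suc n dvd (\<Prod>k<n. 1 - x ^ (2 * k + 1)) * (\<Sum>s\<le>n. x ^ (s * (s + 1) div 2)) -
      (\<Sum>s<n. shanks_term x n s)"
    unfolding sum_shanks_term by (rule dvd_diff_mult_left)
  thus ?thesis using A by (rule dvd_diff_trans)
qed

section \<open>Overpartitions as multiplicity functions\<close>

text \<open>Sorting by this injective key puts the overlined copy of a part before the other ones.\<close>

definition overpartition_key :: "nat \<times> bool \<Rightarrow> int" where
  "overpartition_key x = - (2 * int (fst x) + of_bool (snd x))"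

lemma inj_overpartition_key: "inj overpartition_key"
proof (rule injI)
  fix x y assume "overpartition_key x = overpartition_key y"
  hence "2 * int (fst x) + of_bool (snd x) = 2 * int (fst y) + of_bool (snd y)"
    by (simp add: overpartition_key_def)
  thus "x = y"
    by (cases "snd x"; cases "snd y"; simp add: prod_eq_iff; presburger)
qed

text \<open>Separates the order of the entries from their multiplicities, so that only the latter
  have to be counted. Both order conditions are pairwise, hence the relation
  \<open>?R\<close>.\<close>

lemma overpartition_iff_sorted_count:
  "overpartition n xs \<longleftrightarrow>
     sorted (map overpartition_key xs) \<and> (\<forall>k. count_list xs (k, True) \<le> 1) \<and>
     (\<forall>x\<in>set xs. fst x > 0) \<and> sum_list (map fst xs) = n"
proof -
  let ?R = "\<lambda>x y :: nat \<times> bool. fst x \<ge> fst y \<and> (snd y \<longrightarrow> fst x \<noteq> fst y)"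
  have "sorted_wrt (\<ge>) (map fst xs) \<and>
      (\<forall>i<length xs. snd (xs ! i) \<longrightarrow> (\<forall>j<i. fst (xs ! j) \<noteq> fst (xs ! i))) \<longleftrightarrow> sorted_wrt ?R xs"
    unfolding sorted_wrt_map by (auto simp: sorted_wrt_iff_nth_less)
  moreover have "sorted_wrt ?R xs \<longleftrightarrow>
      sorted (map overpartition_key xs) \<and> (\<forall>k. count_list xs (k, True) \<le> 1)"
  proof (induction xs)
    case (Cons x xs)
    show ?case
    proof (cases "\<forall>k. count_list (x # xs) (k, True) \<le> 1")
      case True
      have "count_list xs (k, True) \<le> 1" for k
        using True[rule_format, of k] by (simp split: if_splits)
      moreover have "?R x y \<longleftrightarrow> overpartition_key x \<le> overpartition_key y" if "y \<in> set xs" for y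
      proof -
        \<comment> \<open>Two overlined copies of one part have equal keys; this is the only case
          where the key order permits more than \<open>?R\<close>.\<close>
        have "\<not> (fst x = fst y \<and> snd x \<and> snd y)"
          using True[rule_format, of "fst x"] that
          by (cases x; cases y) (auto simp: count_list_0_iff)
        thus ?thesis by (auto simp: overpartition_key_def of_bool_def)
      qed
      ultimately show ?thesis using True Cons.IH by auto
    next
      case False
      then obtain k where k: "count_list (x # xs) (k, True) > 1" by (auto simp: not_le)
      have "\<not> sorted_wrt ?R (x # xs)"
      proof
        assume R: "sorted_wrt ?R (x # xs)"
        hence "count_list xs (k, True) \<le> 1" using Cons.IH by simp
        hence "x = (k, True)" "(k, True) \<in> set xs"
          using k by (auto split: if_splits simp: count_list_0_iff intro: ccontr)
        thus False using R by auto
      qed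
      thus ?thesis using False by blast
    qed
  qed simp
  ultimately show ?thesis unfolding overpartition_def by blast
qed

text \<open>A list sorted by an injective key is determined by its multiset.\<close>

lemma overpartition_eqI:
  assumes "overpartition n xs" "overpartition n' ys" "\<And>x. count_list xs x = count_list ys x"
  shows "xs = ys"
proof -
  have "mset xs = mset ys" using assms(3) by (simp add: multiset_eq_iff count_mset)
  hence "mset (map overpartition_key xs) = mset (map overpartition_key ys)" by simp
  moreover have "sorted (map overpartition_key xs)" "sorted (map overpartition_key ys)"
    using assms by (auto simp: overpartition_iff_sorted_count)
  ultimately have "map overpartition_key xs = map overpartition_key ys"
    by (metis properties_for_sort)
  thus ?thesis using inj_overpartition_key by (simp add: inj_map_eq_map)
qed

section \<open>The mex: tail condition and bound\<close>

lemma ex_mex_bar_witness: "\<exists>m>(0::nat). (m, False) \<notin> set xs"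
proof -
  have "finite (fst ` set xs)" by simp
  then obtain b where b: "\<forall>k\<in>fst ` set xs. k \<le> b"
    by (meson finite_nat_set_iff_bounded_le)
  have "(Suc b, False) \<notin> set xs"
  proof
    assume "(Suc b, False) \<in> set xs"
    hence "Suc b \<in> fst ` set xs" by force
    thus False using b by fastforce
  qed
  thus ?thesis by blast
qed

lemma less_mex_bar_iff: "m < mex_bar xs \<longleftrightarrow> (\<forall>k\<in>{1..m}. (k, False) \<in> set xs)"
proof -
  let ?P = "\<lambda>m. m > 0 \<and> (m, False) \<notin> set xs"
  have P: "?P (mex_bar xs)"
    unfolding mex_bar_def using ex_mex_bar_witness by (rule LeastI_ex)
  show ?thesis
  proof
    assume less: "m < mex_bar xs"
    show "\<forall>k\<in>{1..m}. (k, False) \<in> set xs"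
    proof
      fix k assume "k \<in> {1..m}"
      moreover from this have "\<not> ?P k"
        using less by (intro not_less_Least) (simp flip: mex_bar_def)
      ultimately show "(k, False) \<in> set xs" by simp
    qed
  next
    assume "\<forall>k\<in>{1..m}. (k, False) \<in> set xs"
    thus "m < mex_bar xs" using P by (metis Suc_leI One_nat_def atLeastAtMost_iff not_le)
  qed
qed

text \<open>A larger mex would require the part n + 1. The bound lets the tail sum of the mex stop
  at m = n.\<close>

lemma mex_bar_le:
  assumes "overpartition n xs"
  shows "mex_bar xs \<le> Suc n"
proof (rule ccontr)
  assume "\<not> mex_bar xs \<le> Suc n"
  hence "(Suc n, False) \<in> set xs" using less_mex_bar_iff[of "Suc n" xs] by auto
  hence "Suc n \<le> sum_list (map fst xs)" using member_le_sum_list[of "Suc n" "map fst xs"] by force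
  thus False using assms by (simp add: overpartition_def)
qed

text \<open>The multiplicities admissible for one entry when the mex exceeds m. The common cap N
  loses nothing for totals up to N, as all parts are positive.\<close>

definition multiplicities :: "nat \<Rightarrow> nat \<Rightarrow> nat \<times> bool \<Rightarrow> nat set" where
  "multiplicities N m x = (if snd x then {0..1} else if fst x \<le> m then {1..N} else {0..N})"

lemma finite_multiplicities [simp]: "finite (multiplicities N m x)"
  by (simp add: multiplicities_def)

lemma overpartition_count_list:
  assumes "overpartition n xs" "n \<le> N"
  shows "set xs \<subseteq> {1..N} \<times> UNIV" "count_list xs (k, b) \<le> N"
    "(\<Sum>x\<in>{1..N} \<times> UNIV. count_list xs x * fst x) = n"
proof -
  have sum: "sum_list (map fst xs) = n" and pos: "\<forall>x\<in>set xs. fst x > 0"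
    using assms(1) by (auto simp: overpartition_def)
  have le: "fst x \<le> n" if "x \<in> set xs" for x
    using that sum member_le_sum_list[of "fst x" "map fst xs"] by simp
  show sub: "set xs \<subseteq> {1..N} \<times> UNIV"
    using le pos assms(2) by (force simp: Suc_le_eq intro: order_trans)
  show "(\<Sum>x\<in>{1..N} \<times> UNIV. count_list xs x * fst x) = n"
    using sum_list_map_eq_sum_count2[OF sub, of fst] sum by simp
  have "length xs \<le> sum_list (map fst xs)"
    using pos by (induction xs) auto
  thus "count_list xs (k, b) \<le> N"
    using count_le_length[of xs "(k, b)"] sum assms(2) by linarith
qed

text \<open>The inverse forms the multiset with the given multiplicities and sorts it by the
  key.\<close>

lemma bij_betw_overpartition_multiplicities:
  assumes "n \<le> N" "m \<le> N"
  shows "bij_betw (\<lambda>xs. restrict (count_list xs) ({1..N} \<times> UNIV))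
    {xs. overpartition n xs \<and> m < mex_bar xs}
    {g \<in> PiE ({1..N} \<times> UNIV) (multiplicities N m). (\<Sum>x\<in>{1..N} \<times> UNIV. g x * fst x) = n}"
    (is "bij_betw ?\<phi> ?L ?R")
proof -
  let ?C = "{1..N} \<times> (UNIV :: bool set)"
  have "inj_on ?\<phi> ?L"
  proof (rule inj_onI)
    fix xs ys assume xs: "xs \<in> ?L" and ys: "ys \<in> ?L" and eq: "?\<phi> xs = ?\<phi> ys"
    have "count_list xs x = count_list ys x" for x
    proof (cases "x \<in> ?C")
      case True
      thus ?thesis using fun_cong[OF eq, of x] by (simp only: restrict_apply')
    next
      case False
      hence "x \<notin> set xs" "x \<notin> set ys"
        using xs ys overpartition_count_list(1) assms(1) by blast+
      thus ?thesis by simp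
    qed
    thus "xs = ys" using xs ys overpartition_eqI by blast
  qed
  moreover have "?\<phi> xs \<in> ?R" if xs: "xs \<in> ?L" for xs
  proof -
    have op: "overpartition n xs" and mex: "\<forall>k\<in>{1..m}. (k, False) \<in> set xs"
      using xs by (auto simp: less_mex_bar_iff)
    have one: "count_list xs (k, True) \<le> 1" for k
      using op by (simp add: overpartition_iff_sorted_count)
    have pos: "count_list xs (k, False) \<ge> 1" if "k \<in> {1..m}" for k
      using mex that by (metis One_nat_def Suc_leI count_list_0_iff gr0I)
    have "count_list xs x \<in> multiplicities N m x" if x: "x \<in> ?C" for x
    proof -
      obtain k b where [simp]: "x = (k, b)" by force
      show ?thesis
        using one[of k] pos[of k] x overpartition_count_list(2)[OF op assms(1), of k b]
        by (cases b) (auto simp: multiplicities_def)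
    qed
    moreover have "(\<Sum>x\<in>?C. ?\<phi> xs x * fst x) = n"
      using overpartition_count_list(3)[OF op assms(1)] by simp
    ultimately show ?thesis by (simp only: mem_Collect_eq restrict_PiE_iff) blast
  qed
  moreover have "g \<in> ?\<phi> ` ?L" if g: "g \<in> ?R" for g
  proof -
    have gC: "g x \<in> multiplicities N m x" if "x \<in> ?C" for x
      using g that by blast
    \<comment> \<open>Outside \<open>?C\<close> the extensional \<open>g\<close> is
      \<open>undefined\<close>, whereas the multiset needs multiplicity 0 there.\<close>
    let ?f = "\<lambda>x. if x \<in> ?C then g x else 0"
    have "finite {x. ?f x > 0}" by (rule finite_subset[of _ ?C]) auto
    hence count_f: "count (Abs_multiset ?f) = ?f" by (simp add: Abs_multiset_inverse)
    obtain zs where zs: "mset zs = Abs_multiset ?f" using ex_mset by blast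
    define xs where "xs = sort_key overpartition_key zs"
    have count: "count_list xs x = ?f x" for x
      using fun_cong[OF count_f, of x] unfolding xs_def
      by (simp only: flip: count_mset zs) simp
    have set: "set xs \<subseteq> ?C"
    proof
      fix x assume "x \<in> set xs"
      hence "count_list xs x \<noteq> 0" by (simp add: count_list_0_iff)
      thus "x \<in> ?C" unfolding count by presburger
    qed
    have "sum_list (map fst xs) = (\<Sum>x\<in>?C. count_list xs x * fst x)"
      by (rule sum_list_map_eq_sum_count2[OF set]) simp
    also have "\<dots> = (\<Sum>x\<in>?C. g x * fst x)"
      by (intro sum.cong refl) (simp only: count if_True)
    also have "\<dots> = n" using g by blast
    finally have "sum_list (map fst xs) = n" .
    moreover have "count_list xs (k, True) \<le> 1" for k
      using gC[of "(k, True)"] unfolding count by (auto simp: multiplicities_def)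
    ultimately have "overpartition n xs"
      using set by (auto simp: overpartition_iff_sorted_count xs_def)
    moreover have "(k, False) \<in> set xs" if "k \<in> {1..m}" for k
    proof -
      \<comment> \<open>As m \<le> N, the entry lies in \<open>?C\<close>, where its multiplicity is
        at least 1.\<close>
      have "count_list xs (k, False) \<noteq> 0"
        using gC[of "(k, False)"] that assms(2) unfolding count by (auto simp: multiplicities_def)
      thus ?thesis by (simp add: count_list_0_iff)
    qed
    ultimately have "xs \<in> ?L" by (simp add: less_mex_bar_iff)
    moreover have "?\<phi> xs = g"
    proof
      fix x show "?\<phi> xs x = g x"
        using g PiE_arb[of g ?C "multiplicities N m" x] by (cases "x \<in> ?C") (simp_all add: count)
    qed
    ultimately show ?thesis by blast
  qed
  ultimately show ?thesis unfolding bij_betw_def by blast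
qed

section \<open>The generating function\<close>

definition mex_fps :: "nat \<Rightarrow> nat \<Rightarrow> 'a :: comm_ring_1 fps" where
  "mex_fps N m = (\<Prod>x\<in>{1..N} \<times> UNIV. \<Sum>a\<in>multiplicities N m x. fps_X ^ (a * fst x))"

text \<open>Expanding the product chooses one multiplicity per entry, and the exponent is the
  resulting total.\<close>

lemma mex_fps_nth:
  assumes "n \<le> N" "m \<le> N"
  shows "fps_nth (mex_fps N m :: 'a :: comm_ring_1 fps) n =
         of_nat (card {xs. overpartition n xs \<and> m < mex_bar xs})"
proof -
  let ?C = "{1..N} \<times> (UNIV :: bool set)"
  let ?E = "PiE ?C (multiplicities N m)"
  have fin: "finite ?E" by (intro finite_PiE) auto
  have "mex_fps N m = (\<Sum>g\<in>?E. \<Prod>x\<in>?C. fps_X ^ (g x * fst x) :: 'a fps)"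
    unfolding mex_fps_def by (rule prod_sum_PiE) auto
  also have "\<dots> = (\<Sum>g\<in>?E. fps_X ^ (\<Sum>x\<in>?C. g x * fst x))"
    by (simp only: power_sum)
  finally have "fps_nth (mex_fps N m :: 'a fps) n =
      (\<Sum>g\<in>?E. if (\<Sum>x\<in>?C. g x * fst x) = n then 1 else 0)"
    by (simp only: fps_sum_nth) (intro sum.cong refl, simp)
  also have "\<dots> = of_nat (card {g \<in> ?E. (\<Sum>x\<in>?C. g x * fst x) = n})"
    using fin by (simp add: sum.If_cases Int_def)
  finally show ?thesis
    using bij_betw_same_card[OF bij_betw_overpartition_multiplicities[OF assms]] by (simp only:)
qed

lemma sigma_mex_bar_eq_sum:
  "sigma_mex_bar n = (\<Sum>m\<le>n. card {xs. overpartition n xs \<and> m < mex_bar xs})"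
proof -
  have "sigma_mex_bar n = (\<Sum>xs | overpartition n xs. \<Sum>m\<le>n. of_bool (m < mex_bar xs))"
    unfolding sigma_mex_bar_def
  proof (intro sum.cong refl)
    fix xs assume "xs \<in> {xs. overpartition n xs}"
    hence "{m. m \<le> n \<and> m < mex_bar xs} = {..<mex_bar xs}"
      using mex_bar_le[of n xs] by auto
    thus "mex_bar xs = (\<Sum>m\<le>n. of_bool (m < mex_bar xs))"
      by (simp add: of_bool_def sum.If_cases Int_def)
  qed
  also have "\<dots> = (\<Sum>m\<le>n. \<Sum>xs | overpartition n xs. of_bool (m < mex_bar xs))"
    by (rule sum.swap)
  also have "\<dots> = (\<Sum>m\<le>n. card {xs. overpartition n xs \<and> m < mex_bar xs})"
    using finite_overpartitions[of n] by (simp add: of_bool_def sum.If_cases Int_def)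
  finally show ?thesis .
qed

text \<open>The factor 1 - X^k telescopes the sum over multiplicities of the non-overlined part k.
  This leaves X^k for a compulsory part and 1 otherwise, up to X^(k(N+1)); the compulsory parts
  yield the triangular exponent.\<close>

lemma mex_fps_cong:
  assumes "m \<le> N"
  shows "fps_X ^ Suc N dvd (\<Prod>k=1..N. 1 - fps_X ^ k) * mex_fps N m -
           (\<Prod>k=1..N. 1 + fps_X ^ k) * (fps_X ^ (m * (m + 1) div 2) :: 'a :: comm_ring_1 fps)"
proof -
  let ?X = "fps_X :: 'a fps"
  have "(\<Prod>k=1..N. 1 - ?X ^ k) * mex_fps N m =
      (\<Prod>k=1..N. (1 - ?X ^ k) * ((1 + ?X ^ k) * (\<Sum>a\<in>multiplicities N m (k, False). ?X ^ (a * k))))"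
  proof -
    have "mex_fps N m =
        (\<Prod>k=1..N. \<Prod>b\<in>UNIV. \<Sum>a\<in>multiplicities N m (k, b). ?X ^ (a * k))"
      unfolding mex_fps_def prod.cartesian_product by (intro prod.cong) auto
    also have "\<dots> = (\<Prod>k=1..N. (1 + ?X ^ k) * (\<Sum>a\<in>multiplicities N m (k, False). ?X ^ (a * k)))"
    proof (intro prod.cong refl)
      fix k
      have "(\<Sum>a\<in>multiplicities N m (k, True). ?X ^ (a * k)) = 1 + ?X ^ k"
        by (simp add: multiplicities_def)
      thus "(\<Prod>b\<in>UNIV. \<Sum>a\<in>multiplicities N m (k, b). ?X ^ (a * k)) =
          (1 + ?X ^ k) * (\<Sum>a\<in>multiplicities N m (k, False). ?X ^ (a * k))"
        by (simp add: UNIV_bool mult.commute)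
    qed
    finally show ?thesis by (simp only: prod.distrib)
  qed
  moreover have "?X ^ Suc N dvd \<dots> - (\<Prod>k=1..N. (1 + ?X ^ k) * (if k \<le> m then ?X ^ k else 1))"
  proof (rule dvd_diff_prod)
    fix k assume k: "k \<in> {1..N}"
    \<comment> \<open>The lower limit is the compulsory copy of each k \<le> m.\<close>
    let ?e = "if k \<le> m then 1 else 0 :: nat"
    have "multiplicities N m (k, False) = {?e..<Suc N}"
      by (auto simp: multiplicities_def)
    hence "(1 - ?X ^ k) * (\<Sum>a\<in>multiplicities N m (k, False). ?X ^ (a * k)) =
        (\<Sum>a=?e..<Suc N. ?X ^ (a * k) - ?X ^ (Suc a * k))"
      by (simp only: sum_distrib_left) (intro sum.cong refl, simp add: algebra_simps power_add)
    also have "\<dots> = - (\<Sum>a=?e..<Suc N. ?X ^ (Suc a * k) - ?X ^ (a * k))"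
      by (simp only: minus_diff_eq flip: sum_negf)
    also have "\<dots> = ?X ^ (?e * k) - ?X ^ (Suc N * k)"
      by (subst sum_Suc_diff') auto
    finally have "(1 - ?X ^ k) * (\<Sum>a\<in>multiplicities N m (k, False). ?X ^ (a * k)) =
        (if k \<le> m then ?X ^ k else 1) - ?X ^ (Suc N * k)"
      by (simp split: if_splits)
    hence tel: "(1 - ?X ^ k) * (\<Sum>a\<in>multiplicities N m (k, False). ?X ^ (a * k)) -
        (if k \<le> m then ?X ^ k else 1) = - (?X ^ (Suc N * k))"
      by simp
    have "(1 - ?X ^ k) * ((1 + ?X ^ k) * (\<Sum>a\<in>multiplicities N m (k, False). ?X ^ (a * k))) -
        (1 + ?X ^ k) * (if k \<le> m then ?X ^ k else 1) =
        (1 + ?X ^ k) * ((1 - ?X ^ k) * (\<Sum>a\<in>multiplicities N m (k, False). ?X ^ (a * k)) -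
          (if k \<le> m then ?X ^ k else 1))"
      by (simp only: algebra_simps)
    also have "\<dots> = - (1 + ?X ^ k) * ?X ^ (Suc N * k)"
      unfolding tel by (simp only: mult_minus_left mult_minus_right)
    finally show "?X ^ Suc N dvd
        (1 - ?X ^ k) * ((1 + ?X ^ k) * (\<Sum>a\<in>multiplicities N m (k, False). ?X ^ (a * k))) -
        (1 + ?X ^ k) * (if k \<le> m then ?X ^ k else 1)"
      \<comment> \<open>Since k \<ge> 1, the error exponent k(N+1) is at least N + 1.\<close>
      using k mult_le_mono1[of 1 k "Suc N"]
      by (simp only:) (intro dvd_mult le_imp_power_dvd, simp add: mult.commute)
  qed
  moreover have "(\<Prod>k=1..N. if k \<le> m then ?X ^ k else 1) = ?X ^ (m * (m + 1) div 2)"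
  proof -
    have "(\<Prod>k=1..N. if k \<le> m then ?X ^ k else 1) = (\<Prod>k=1..m. ?X ^ k)"
      using assms by (intro prod.mono_neutral_cong_right) auto
    also have "\<dots> = ?X ^ (\<Sum>k=1..m. k)"
      by (rule power_sum[symmetric])
    also have "(\<Sum>k=1..m. k) = m * (m + 1) div 2"
      using gauss_sum_from_Suc_0[of m, where 'a = nat] by simp
    finally show ?thesis .
  qed
  ultimately show ?thesis by (simp only: prod.distrib)
qed

section \<open>Comparison of coefficients modulo X^(n+1)\<close>

theorem theorem1p1:
  fixes n :: nat
  assumes "n \<ge> 1"
  shows "sigma_mex_bar n = D3 n"
proof -
  \<comment> \<open>The rationals form a field, as cancelling units requires, and have
    characteristic 0, so equal coefficients give equal naturals.\<close>
  let ?X = "fps_X :: rat fps"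
  let ?E = "\<Prod>k=1..n. 1 - ?X ^ k" and ?D = "\<Prod>k=1..n. 1 + ?X ^ k"
    and ?Q = "\<Prod>k<n. 1 - ?X ^ (2 * k + 1)" and ?S = "\<Sum>m\<le>n. ?X ^ (m * (m + 1) div 2)"
    and ?F = "\<Sum>m\<le>n. mex_fps n m :: rat fps"
  have "?X ^ Suc n dvd (\<Sum>m\<le>n. ?E * mex_fps n m - ?D * ?X ^ (m * (m + 1) div 2))"
    by (intro dvd_sum mex_fps_cong) simp
  hence "?X ^ Suc n dvd ?E * ?F - ?D * ?S"
    by (simp only: sum_subtractf sum_distrib_left)
  hence "?X ^ Suc n dvd ?Q * (?E * ?F) - ?Q * (?D * ?S)"
    by (rule dvd_diff_mult_left)
  \<comment> \<open>Gauss: \<open>?Q * ?S\<close> is congruent to the even product, which is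
    \<open>?E * ?D\<close>.\<close>
  moreover have "?X ^ Suc n dvd ?D * (?Q * ?S) - ?D * (?E * ?D)"
    using gauss_triangular[OF assms, of ?X] unfolding prod_one_minus_even
    by (rule dvd_diff_mult_left)
  hence "?X ^ Suc n dvd ?Q * (?D * ?S) - ?E * (?D * ?D)"
    by (simp only: mult_ac)
  ultimately have "?X ^ Suc n dvd ?Q * (?E * ?F) - ?E * (?D * ?D)"
    by (rule dvd_diff_trans)
  hence "?X ^ Suc n dvd ?E * (?Q * ?F - ?D * ?D)"
    by (simp only: right_diff_distrib mult_ac)
  hence "?X ^ Suc n dvd ?Q * ?F - ?D * ?D"
    by (rule fps_X_power_dvd_cancel) (subst prod_one_minus_X_nth_0, simp)
  hence "?X ^ Suc n dvd ?D * (?Q * ?F) - ?D * (?D * ?D)"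
    by (rule dvd_diff_mult_left)
  \<comment> \<open>Euler: \<open>?Q\<close> and \<open>?D\<close> are inverse modulo X^(n+1), so
    multiplying by \<open>?D\<close> removes \<open>?Q\<close> and supplies the third
    factor.\<close>
  moreover have "?X ^ Suc n dvd (?Q * ?D) * ?F - 1 * ?F"
    by (rule dvd_diff_mult[OF euler_odd_distinct]) simp
  hence "?X ^ Suc n dvd ?F - ?D * (?Q * ?F)"
    by (subst dvd_diff_commute) (simp only: mult_1_left mult_ac)
  ultimately have "?X ^ Suc n dvd ?F - ?D * (?D * ?D)"
    by (rule dvd_diff_trans[rotated])
  hence "fps_nth ?F n = fps_nth (?D * (?D * ?D)) n"
    by (simp only: fps_X_power_dvd_iff fps_sub_nth) simp
  also have "?D * (?D * ?D) = (\<Prod>j=1..n. (1 + ?X ^ j) ^ 3)"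
    by (simp only: power3_eq_cube prod.distrib mult_ac)
  also have "fps_nth \<dots> n = of_nat (D3 n)"
    by (rule D3_partial_product) simp
  finally have "of_nat (sigma_mex_bar n) = (of_nat (D3 n) :: rat)"
    by (simp add: fps_sum_nth mex_fps_nth sigma_mex_bar_eq_sum)
  thus ?thesis by simp
qed

end
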